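(* Let $\tau>0$, $\delta\ge 0$, let $f:\mathbb{R}\times\mathbb{R}^n\to\mathbb{R}^n$ and $g:\mathbb{R}\times\mathbb{R}^n\to\mathbb{R}^{n\times m}$ be locally Lipschitz continuous, let $d:\mathbb{R}\to\mathbb{R}^m$ satisfy $\|d(t)\|\le\delta$ for all $t\ge 0$, and consider the control system with input delay and input disturbance $$\dot x(t)=f(t,x(t))+g(t,x(t))\big(u(t-\tau)+d(t)\big). \qquad (\ast)$$ Let $h:\mathbb{R}^n\to\mathbb{R}$ be continuously differentiable, and let $\sigma:\mathbb{R}\to\mathbb{R}_{>0}$ be continuously differentiable with $\sigma'(r)\le 0$ for all $r\in\mathbb{R}$. Suppose that $h$ is a tunable input-to-state safe control barrier function (TISSf-CBF) for $(\ast)$ with $\sigma$ and with a function $\alpha\in\mathcal{K}^{\rm e}_\infty$ (see context) whose inverse $\alpha^{-1}\in\mathcal{K}^{\rm e}_\infty$ is continuously differentiable. Let $k:\mathbb{R}\times\mathbb{R}^n\times\mathcal{B}\to\mathbb{R}^m$ be any locally Lipschitz continuous controller satisfying, for all $t\ge 0$, all $x\in\mathbb{R}^n$ and all $u_t\in\mathcal{B}$, $$\dot h\big(t_{\rm p},x_{\rm p},k(t,x,u_t)\big)\ \ge\ -\alpha(h(x_{\rm p}))+\sigma(h(x_{\rm p}))\,\|L_gh(t_{\rm p},x_{\rm p})\|^2,$$ where $t_{\rm p}=t+\tau$ and $x_{\rm p}=\Psi_d(\tau,t,x,u_t)$. Define $$\gamma(r,\delta)=-\alpha^{-1}\!\left(-\frac{\delta^2}{4\sigma(r)}\right),\qquad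 h_\delta(x)=h(x)+\gamma(h(x),\delta),\qquad S_\delta=\{x\in\mathbb{R}^n: h_\delta(x)\ge 0\}.$$ Then the controller $u(t)=k(t,x(t),u_t)$, $t\ge 0$, renders $S_\delta$ forward invariant in the following sense: for every solution $x(t)$ of the resulting closed-loop system, $$x(t)\in S_\delta\ \ \forall t\in[0,\tau]\quad\Longrightarrow\quad x(t)\in S_\delta\ \ \forall t\ge 0.$$
   Context: Comparison functions. A function $\alpha:\mathbb{R}\to\mathbb{R}$ is of extended class-$\mathcal{K}_\infty$, written $\alpha\in\mathcal{K}^{\rm e}_\infty$, if it is continuous, strictly monotonically increasing, $\alpha(0)=0$, $\lim_{r\to\infty}\alpha(r)=\infty$ and $\lim_{r\to-\infty}\alpha(r)=-\infty$. Input histories. $\mathcal{B}$ denotes the space of functions $[-\tau,0)\to\mathbb{R}^m$ that are bounded and continuous almost everywhere (with the supremum norm). For an input signal $u$, the input history at time $t$ is $u_t\in\mathcal{B}$, $u_t(\theta)=u(t+\theta)$, $\theta\in[-\tau,0)$. In conditions quantified over "all $u_t\in\mathcal{B}$", $u_t$ stands for an arbitrary element of $\mathcal{B}$. Derivative of $h$. $\|\cdot\|$ is the Euclidean norm. With $\nabla h(x)$ the gradient as a row vector, for $t\in\mathbb{R}$, $x\in\mathbb{R}^n$, $u\in\mathbb{R}^m$: $L_fh(t,x)=\nabla h(x)f(t,x)$, $L_gh(t,x)=\nabla h(x)g(t,x)$, and $\dot h(t,x,u)=L_fh(t,x)+L_gh(t,x)u$. Semi-flow with disturbance (exact predictor).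 $\Psi_d:[0,\tau]\times\mathbb{R}\times\mathbb{R}^n\times\mathcal{B}\to\mathbb{R}^n$ is the solution map of the system over a time window of length $\tau$, given by $$\Psi_d(\vartheta,t,x,u_t)=x+\int_0^\vartheta\Big(f\big(t+s,\Psi_d(s,t,x,u_t)\big)+g\big(t+s,\Psi_d(s,t,x,u_t)\big)\big(u_t(s-\tau)+d(t+s)\big)\Big)\,{\rm d}s,$$ and is assumed well defined. Along a solution $x(\cdot)$ with input $u$, $x(t+\vartheta)=\Psi_d(\vartheta,t,x(t),u_t)$ for $\vartheta\in[0,\tau]$; in particular $x(t+\tau)=\Psi_d(\tau,t,x(t),u_t)$. TISSf-CBF with input delay. A function $h:\mathbb{R}^n\to\mathbb{R}$ is a TISSf-CBF for the system $\dot x(t)=f(t,x(t))+g(t,x(t))(u(t-\tau)+d(t))$ with a continuously differentiable function $\sigma:\mathbb{R}\to\mathbb{R}_{>0}$ if there exists $\alpha\in\mathcal{K}^{\rm e}_\infty$ such that for all $t\ge 0$, $x\in\mathbb{R}^n$ and $u_t\in\mathcal{B}$, $$\sup_{u\in\mathbb{R}^m}\dot h(t_{\rm p},x_{\rm p},u)>-\alpha(h(x_{\rm p}))+\sigma(h(x_{\rm p}))\|L_gh(t_{\rm p},x_{\rm p})\|^2,\qquad t_{\rm p}=t+\tau,\ x_{\rm p}=\Psi_d(\tau,t,x,u_t).$$ The same $\alpha$ is used in the condition on the controller and in $\gamma$. Standing assumptions. For a given initial state $x(0)\in\mathbb{R}^n$ and initial input history $u_0\in\mathcal{B}$, the solution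 $x(t)$ of the closed-loop system (with $u(t)=k(t,x(t),u_t)$ for $t\ge0$, and $u$ on $[-\tau,0)$ given by $u_0$) is assumed to exist for all $t\ge 0$, with $u_t\in\mathcal{B}$ for all $t\ge 0$. Solutions are understood in the integral sense, as in the formula for $\Psi_d$. *)

theory Defs
  imports "HOL-Analysis.Analysis" "HOL-Library.Extended_Real"
begin

definition ext_class_K_inf :: "(real \<Rightarrow> real) set" where
  "ext_class_K_inf = {\<alpha>. continuous_on UNIV \<alpha> \<and> strict_mono \<alpha> \<and> \<alpha> 0 = 0 \<and>
     filterlim \<alpha> at_top at_top \<and> filterlim \<alpha> at_bot at_bot}"

definition locally_lipschitz :: "('a::metric_space \<Rightarrow> 'b::metric_space) \<Rightarrow> bool" where
  "locally_lipschitz F \<longleftrightarrow> (\<forall>p. \<exists>\<epsilon>>0. \<exists>L. L-lipschitz_on (ball p \<epsilon>) F)"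

definition gradient :: "(real^'n \<Rightarrow> real) \<Rightarrow> real^'n \<Rightarrow> real^'n" where
  "gradient h x = (THE v. GDERIV h x :> v)"

definition continuously_differentiable :: "(real^'n \<Rightarrow> real) \<Rightarrow> bool" where
  "continuously_differentiable h \<longleftrightarrow>
     (\<forall>x. h differentiable (at x)) \<and> continuous_on UNIV (gradient h)"

text \<open>A function on \<open>[-\<tau>, 0)\<close> is represented by its extensional extension (the value
  outside \<open>[-\<tau>, 0)\<close> is the fixed junk value \<open>undefined\<close>), so that a controller or a flow
  taking such a function as argument can only depend on its values on \<open>[-\<tau>, 0)\<close>.\<close>

definition histories :: "real \<Rightarrow> (real \<Rightarrow> real^'m) set" where
  "histories \<tau> = {\<phi> \<in> extensional {-\<tau>..<0}. bounded (\<phi> ` {-\<tau>..<0}) \<and>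
     (AE \<theta> in lebesgue. \<theta> \<in> {-\<tau>..<0} \<longrightarrow> continuous (at \<theta> within {-\<tau>..<0}) \<phi>)}"

definition history :: "real \<Rightarrow> (real \<Rightarrow> real^'m) \<Rightarrow> real \<Rightarrow> (real \<Rightarrow> real^'m)" where
  "history \<tau> u t = (\<lambda>\<theta>\<in>{-\<tau>..<0}. u (t + \<theta>))"

definition history_dist :: "real \<Rightarrow> (real \<Rightarrow> real^'m) \<Rightarrow> (real \<Rightarrow> real^'m) \<Rightarrow> real" where
  "history_dist \<tau> \<phi> \<psi> = (SUP \<theta>\<in>{-\<tau>..<0}. norm (\<phi> \<theta> - \<psi> \<theta>))"

text \<open>Local Lipschitz continuity on \<open>\<real> \<times> \<real>\<^sup>n \<times> histories \<tau>\<close>, with the supremum norm on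
  histories and the sum metric on the product.\<close>

definition locally_lipschitz_controller ::
  "real \<Rightarrow> (real \<Rightarrow> real^'n \<Rightarrow> (real \<Rightarrow> real^'m) \<Rightarrow> real^'m) \<Rightarrow> bool" where
  "locally_lipschitz_controller \<tau> k \<longleftrightarrow>
     (\<forall>t x. \<forall>\<phi>\<in>histories \<tau>. \<exists>\<epsilon>>0. \<exists>L. \<forall>t1 x1 t2 x2. \<forall>\<phi>1\<in>histories \<tau>. \<forall>\<phi>2\<in>histories \<tau>.
        dist t1 t + dist x1 x + history_dist \<tau> \<phi>1 \<phi> < \<epsilon> \<longrightarrow>
        dist t2 t + dist x2 x + history_dist \<tau> \<phi>2 \<phi> < \<epsilon> \<longrightarrow>
        dist (k t1 x1 \<phi>1) (k t2 x2 \<phi>2) \<le> L * (dist t1 t2 + dist x1 x2 + history_dist \<tau> \<phi>1 \<phi>2))"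

definition vector_field ::
  "(real \<Rightarrow> real^'n \<Rightarrow> real^'n) \<Rightarrow> (real \<Rightarrow> real^'n \<Rightarrow> real^'m^'n) \<Rightarrow>
   real \<Rightarrow> real^'n \<Rightarrow> real^'m \<Rightarrow> real^'n" where
  "vector_field f g t x v = f t x + g t x *v v"

definition Lf :: "(real \<Rightarrow> real^'n \<Rightarrow> real^'n) \<Rightarrow> (real^'n \<Rightarrow> real) \<Rightarrow> real \<Rightarrow> real^'n \<Rightarrow> real" where
  "Lf f h t x = gradient h x \<bullet> f t x"

definition Lg ::
  "(real \<Rightarrow> real^'n \<Rightarrow> real^'m^'n) \<Rightarrow> (real^'n \<Rightarrow> real) \<Rightarrow> real \<Rightarrow> real^'n \<Rightarrow> real^'m" where
  "Lg g h t x = gradient h x v* g t x"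

definition hdot ::
  "(real \<Rightarrow> real^'n \<Rightarrow> real^'n) \<Rightarrow> (real \<Rightarrow> real^'n \<Rightarrow> real^'m^'n) \<Rightarrow> (real^'n \<Rightarrow> real) \<Rightarrow>
   real \<Rightarrow> real^'n \<Rightarrow> real^'m \<Rightarrow> real" where
  "hdot f g h t x u = Lf f h t x + Lg g h t x \<bullet> u"

text \<open>Integral equations are understood in the Lebesgue sense: the integrand is required to be
  absolutely integrable, so that \<open>integral\<close> is its Lebesgue integral. In particular,
  well-definedness of the flow includes integrability of the disturbance term.\<close>

definition semiflow ::
  "real \<Rightarrow> (real \<Rightarrow> real^'n \<Rightarrow> real^'n) \<Rightarrow> (real \<Rightarrow> real^'n \<Rightarrow> real^'m^'n) \<Rightarrow> (real \<Rightarrow> real^'m) \<Rightarrow>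
   (real \<Rightarrow> real \<Rightarrow> real^'n \<Rightarrow> (real \<Rightarrow> real^'m) \<Rightarrow> real^'n) \<Rightarrow> bool" where
  "semiflow \<tau> f g d \<Psi> \<longleftrightarrow>
     (\<forall>\<theta>\<in>{0..\<tau>}. \<forall>t x. \<forall>\<phi>\<in>histories \<tau>.
        (\<lambda>s. vector_field f g (t + s) (\<Psi> s t x \<phi>) (\<phi> (s - \<tau>) + d (t + s)))
           absolutely_integrable_on {0..\<theta>} \<and>
        \<Psi> \<theta> t x \<phi> = x + integral {0..\<theta>}
          (\<lambda>s. vector_field f g (t + s) (\<Psi> s t x \<phi>) (\<phi> (s - \<tau>) + d (t + s))))"

definition closed_loop_solution ::
  "real \<Rightarrow> (real \<Rightarrow> real^'n \<Rightarrow> real^'n) \<Rightarrow> (real \<Rightarrow> real^'n \<Rightarrow> real^'m^'n) \<Rightarrow> (real \<Rightarrow> real^'m) \<Rightarrow>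
   (real \<Rightarrow> real^'n \<Rightarrow> (real \<Rightarrow> real^'m) \<Rightarrow> real^'m) \<Rightarrow>
   (real \<Rightarrow> real^'n) \<Rightarrow> (real \<Rightarrow> real^'m) \<Rightarrow> bool" where
  "closed_loop_solution \<tau> f g d k x u \<longleftrightarrow>
     (\<forall>t\<ge>0. history \<tau> u t \<in> histories \<tau> \<and>
        u t = k t (x t) (history \<tau> u t) \<and>
        (\<lambda>s. vector_field f g s (x s) (u (s - \<tau>) + d s)) absolutely_integrable_on {0..t} \<and>
        x t = x 0 + integral {0..t} (\<lambda>s. vector_field f g s (x s) (u (s - \<tau>) + d s)))"

text \<open>The comparison function \<open>\<alpha>\<close> is an explicit argument, because it also enters the controller
  condition and \<open>\<gamma>\<close>; being a TISSf-CBF means that this holds for some \<open>\<alpha>\<close>. The supremum is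
  taken in the extended reals, since it is infinite wherever \<open>Lg g h\<close> does not vanish.\<close>

definition TISSf_CBF_with ::
  "real \<Rightarrow> (real \<Rightarrow> real^'n \<Rightarrow> real^'n) \<Rightarrow> (real \<Rightarrow> real^'n \<Rightarrow> real^'m^'n) \<Rightarrow>
   (real \<Rightarrow> real \<Rightarrow> real^'n \<Rightarrow> (real \<Rightarrow> real^'m) \<Rightarrow> real^'n) \<Rightarrow>
   (real \<Rightarrow> real) \<Rightarrow> (real \<Rightarrow> real) \<Rightarrow> (real^'n \<Rightarrow> real) \<Rightarrow> bool" where
  "TISSf_CBF_with \<tau> f g \<Psi> \<sigma> \<alpha> h \<longleftrightarrow> \<alpha> \<in> ext_class_K_inf \<and>
     (\<forall>t\<ge>0. \<forall>x. \<forall>\<phi>\<in>histories \<tau>. let tp = t + \<tau>; xp = \<Psi> \<tau> t x \<phi> in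
        (SUP u. ereal (hdot f g h tp xp u))
          > ereal (- \<alpha> (h xp) + \<sigma> (h xp) * (norm (Lg g h tp xp))\<^sup>2))"

definition tissf_gamma :: "(real \<Rightarrow> real) \<Rightarrow> (real \<Rightarrow> real) \<Rightarrow> real \<Rightarrow> real \<Rightarrow> real" where
  "tissf_gamma \<alpha> \<sigma> r \<delta> = - inv \<alpha> (- (\<delta>\<^sup>2 / (4 * \<sigma> r)))"

definition h_delta ::
  "(real \<Rightarrow> real) \<Rightarrow> (real \<Rightarrow> real) \<Rightarrow> (real^'n \<Rightarrow> real) \<Rightarrow> real \<Rightarrow> real^'n \<Rightarrow> real" where
  "h_delta \<alpha> \<sigma> h \<delta> x = h x + tissf_gamma \<alpha> \<sigma> (h x) \<delta>"

definition S_delta ::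
  "(real \<Rightarrow> real) \<Rightarrow> (real \<Rightarrow> real) \<Rightarrow> (real^'n \<Rightarrow> real) \<Rightarrow> real \<Rightarrow> (real^'n) set" where
  "S_delta \<alpha> \<sigma> h \<delta> = {x. h_delta \<alpha> \<sigma> h \<delta> x \<ge> 0}"

end

theory Submission
  imports Defs
begin

text \<open>
  Along a solution, the flow property \<open>x (t + \<tau>) = \<Psi> \<tau> t (x t) (history \<tau> u t)\<close> turns the controller
  condition into a bound on \<open>hdot\<close> at \<open>x s\<close> for every \<open>s \<ge> \<tau>\<close>. After completing the square,
  \<open>r = h (x s)\<close> satisfies \<open>r' \<ge> - \<beta> r\<close> with the strictly increasing function
  \<open>\<beta> r = \<alpha> r + \<delta>\<^sup>2 / (4 * \<sigma> r)\<close>, and \<open>S_delta\<close> is the set where \<open>\<beta> (h x) \<ge> 0\<close>. If a solution left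
  this set, \<open>h\<close> would be nondecreasing from the last time at which \<open>\<beta> = 0\<close>, a contradiction.
\<close>

section \<open>Gradients and monotonicity along integral curves\<close>

text \<open>Since \<open>gradient\<close> is a definite description, using it takes existence and
  uniqueness. The derivative \<open>h'\<close> is a linear functional, represented by the vector
  \<open>adjoint h' 1\<close>; uniqueness of derivatives makes any other representing vector agree
  with it in every inner product.\<close>

lemma gderiv_gradient:
  assumes "h differentiable (at x)"
  shows "GDERIV h x :> gradient h x"
proof -
  obtain h' where h': "(h has_derivative h') (at x)"
    using assms by (auto simp: differentiable_def)
  have "linear h'"
    using h' has_derivative_linear by blast
  then have "h' = (\<lambda>v. v \<bullet> adjoint h' 1)"
    by (auto simp: adjoint_works)
  then have ex: "GDERIV h x :> adjoint h' 1"
    using h' by (simp add: gderiv_def)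
  show ?thesis
    unfolding gradient_def
  proof (rule theI[where P = "\<lambda>v. GDERIV h x :> v", OF ex])
    fix v
    assume "GDERIV h x :> v"
    then have "(\<lambda>y. y \<bullet> v) = (\<lambda>y. y \<bullet> adjoint h' 1)"
      using ex has_derivative_unique unfolding gderiv_def by blast
    then have "\<forall>z. z \<bullet> v = z \<bullet> adjoint h' 1"
      by (simp add: fun_eq_iff)
    then show "v = adjoint h' 1"
      using vector_eq_ldot by blast
  qed
qed

text \<open>The one-variable mean value theorem is applied on the parametrised segment. Keeping
  \<xi> on the segment allows convexity to confine it to any ball that contains both end
  points.\<close>

lemma mvt_gradient:
  assumes "\<And>x. h differentiable (at x)"
  shows "\<exists>\<xi>\<in>closed_segment p q. h q - h p = gradient h \<xi> \<bullet> (q - p)"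
proof -
  define c where "c = (\<lambda>r::real. p + r *\<^sub>R (q - p))"
  have "((h \<circ> c) has_derivative (\<lambda>y. (y *\<^sub>R (q - p)) \<bullet> gradient h (c r))) (at r within {0..1})" for r
  proof -
    have "(c has_derivative (\<lambda>y. y *\<^sub>R (q - p))) (at r within {0..1})"
      unfolding c_def by (auto intro!: derivative_eq_intros)
    moreover have "(h has_derivative (\<lambda>y. y \<bullet> gradient h (c r))) (at (c r))"
      using gderiv_gradient[OF assms] by (simp add: gderiv_def)
    ultimately show ?thesis
      using has_derivative_compose by (fastforce simp: o_def)
  qed
  from mvt_very_simple[of 0 1 "h \<circ> c", OF _ this] obtain r
    where r: "r \<in> {0..1}" "h (c 1) - h (c 0) = (q - p) \<bullet> gradient h (c r)"
    by auto
  then have "c r \<in> closed_segment p q"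
    by (auto simp: c_def closed_segment_def algebra_simps intro!: exI[of _ r])
  moreover have "h q - h p = gradient h (c r) \<bullet> (q - p)"
    using r(2) by (simp add: c_def inner_commute)
  ultimately show ?thesis ..
qed

text \<open>As \<open>F\<close> is only absolutely integrable, \<open>x\<close> need not be
  differentiable at every time, so the argument avoids a pointwise chain rule. On short intervals
  the gradient is nearly constant and can be moved under the integral; the resulting error is a
  small multiple of the integral of \<open>norm (F r)\<close>, which adds up over subintervals and
  vanishes in the limit.\<close>

lemma nondecreasing_along_integral_curve:
  fixes h :: "real^'n \<Rightarrow> real" and x F :: "real \<Rightarrow> real^'n"
  assumes h: "continuously_differentiable h"
    and F: "F absolutely_integrable_on {a..b}"
    and x: "\<And>t. t \<in> {a..b} \<Longrightarrow> x t = x a + integral {a..t} F"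
    and nonneg: "\<And>t. t \<in> {a..b} \<Longrightarrow> 0 \<le> gradient h (x t) \<bullet> F t"
    and "a \<le> b"
  shows "h (x a) \<le> h (x b)"
proof -
  have intF: "F integrable_on {s..t}" "(\<lambda>r. norm (F r)) integrable_on {s..t}"
    if "a \<le> s" "t \<le> b" for s t
  proof -
    have "F absolutely_integrable_on {s..t}"
      using F absolutely_integrable_on_subinterval that by (metis atLeastatMost_subset_iff)
    then show "F integrable_on {s..t}" "(\<lambda>r. norm (F r)) integrable_on {s..t}"
      by (auto simp: absolutely_integrable_on_def)
  qed
  have "continuous_on {a..b} (\<lambda>t. x a + integral {a..t} F)"
    by (intro continuous_intros indefinite_integral_continuous_1 intF) auto
  then have cont: "continuous_on {a..b} x"
    using x continuous_on_cong by (metis (no_types, lifting))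
  have diff: "x t - x s = integral {s..t} F" if "a \<le> s" "s \<le> t" "t \<le> b" for s t
    using Henstock_Kurzweil_Integration.integral_combine[OF that(1,2) intF(1)] x[of s] x[of t] that
    by (auto simp: algebra_simps)
  have approx: "- 2 * e * integral {a..b} (\<lambda>r. norm (F r)) \<le> h (x b) - h (x a)"
    if "e > 0" for e
  proof -
    \<comment> \<open>Both sides of the inequality are additive in the interval, so Bolzano's
      bisection principle reduces it to short intervals around each point \<open>z\<close>.\<close>
    define P where "P = (\<lambda>s t. a \<le> s \<and> t \<le> b \<longrightarrow>
      - 2 * e * integral {s..t} (\<lambda>r. norm (F r)) \<le> h (x t) - h (x s))"
    have "P a b"
      using \<open>a \<le> b\<close>
    proof (induction rule: Bolzano)
      case (trans s t u)
      show ?case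
        unfolding P_def
      proof
        assume su: "a \<le> s \<and> u \<le> b"
        then have "integral {s..u} (\<lambda>r. norm (F r))
            = integral {s..t} (\<lambda>r. norm (F r)) + integral {t..u} (\<lambda>r. norm (F r))"
          using Henstock_Kurzweil_Integration.integral_combine[OF trans(3,4) intF(2)] by auto
        then show "- 2 * e * integral {s..u} (\<lambda>r. norm (F r)) \<le> h (x u) - h (x s)"
          using trans su by (simp add: P_def algebra_simps)
      qed
    next
      case (local z)
      have "isCont (gradient h) (x z)"
        using h by (auto simp: continuously_differentiable_def continuous_on_eq_continuous_at)
      then obtain \<rho> where \<rho>: "\<rho> > 0"
        "\<And>y. dist y (x z) < \<rho> \<Longrightarrow> dist (gradient h y) (gradient h (x z)) < e"
        using \<open>e > 0\<close> by (metis continuous_at_eps_delta)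
      obtain \<eta> where \<eta>: "\<eta> > 0"
        "\<And>y. y \<in> {a..b} \<Longrightarrow> dist y z < \<eta> \<Longrightarrow> dist (x y) (x z) < \<rho>"
        using cont local \<rho>(1) unfolding continuous_on_iff by (metis atLeastAtMost_iff)
      have "- 2 * e * integral {s..t} (\<lambda>r. norm (F r)) \<le> h (x t) - h (x s)"
        if "s \<le> z" "z \<le> t" "t - s < \<eta>" "a \<le> s" "t \<le> b" for s t
      proof -
        have near: "x r \<in> ball (x z) \<rho>" if "r \<in> {s..t}" for r
          using \<eta>(2)[of r] that \<open>s \<le> z\<close> \<open>z \<le> t\<close> \<open>t - s < \<eta>\<close> \<open>a \<le> s\<close> \<open>t \<le> b\<close>
          by (auto simp: dist_commute dist_real_def)
        obtain \<xi> where \<xi>: "\<xi> \<in> closed_segment (x s) (x t)"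
          "h (x t) - h (x s) = gradient h \<xi> \<bullet> (x t - x s)"
          using mvt_gradient h by (metis continuously_differentiable_def)
        have "\<xi> \<in> ball (x z) \<rho>"
          using \<xi>(1) near[of s] near[of t] that closed_segment_subset[OF _ _ convex_ball]
          by (metis (no_types, lifting) atLeastAtMost_iff order.trans order_refl subsetD)
        \<comment> \<open>The sign hypothesis concerns the gradient at \<open>x r\<close>, while the
          mean value theorem provides it at the fixed point \<xi>. Each is within \<open>e\<close>
          of the gradient at \<open>x z\<close>, whence the factor 2.\<close>
        have low: "- 2 * e * norm (F r) \<le> gradient h \<xi> \<bullet> F r" if "r \<in> {s..t}" for r
        proof -
          have "dist (gradient h \<xi>) (gradient h (x z)) < e" "dist (gradient h (x r)) (gradient h (x z)) < e"
            using \<open>\<xi> \<in> ball (x z) \<rho>\<close> near[OF that] by (auto intro!: \<rho> simp: dist_commute)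
          then have "norm (gradient h (x r) - gradient h \<xi>) \<le> 2 * e"
            by (metis dist_norm dist_triangle_less_add mult_2 less_imp_le dist_commute)
          then have "(gradient h (x r) - gradient h \<xi>) \<bullet> F r \<le> 2 * e * norm (F r)"
            by (meson mult_right_mono norm_cauchy_schwarz norm_ge_zero order_trans)
          then show ?thesis
            using nonneg[of r] that \<open>a \<le> s\<close> \<open>t \<le> b\<close> by (auto simp: inner_diff_left)
        qed
        have "(F has_integral (x t - x s)) {s..t}"
          using diff intF(1) that by (metis integrable_integral order_trans)
        then have up: "((\<lambda>r. gradient h \<xi> \<bullet> F r) has_integral (gradient h \<xi> \<bullet> (x t - x s))) {s..t}"
          using has_integral_linear[OF _ bounded_linear_inner_right] by (force simp: o_def)
        have "((\<lambda>r. - 2 * e * norm (F r)) has_integral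
            - 2 * e * integral {s..t} (\<lambda>r. norm (F r))) {s..t}"
          using intF(2) that by (intro has_integral_mult_right integrable_integral) auto
        from has_integral_le[OF this up low] show ?thesis
          by (simp add: \<xi>(2))
      qed
      with \<eta>(1) show ?case
        unfolding P_def by blast
    qed
    then show ?thesis by (simp add: P_def)
  qed
  define I where "I = integral {a..b} (\<lambda>r. norm (F r))"
  \<comment> \<open>The total \<open>I\<close> does not depend on \<open>e\<close>, so the error
    disappears as \<open>e\<close> tends to 0 from the right.\<close>
  have "((\<lambda>e. - 2 * e * I) \<longlongrightarrow> - 2 * 0 * I) (at_right 0)"
    by (intro tendsto_intros)
  moreover have "\<forall>\<^sub>F e in at_right 0. - 2 * e * I \<le> h (x b) - h (x a)"
    unfolding I_def using eventually_at_right_less by (rule eventually_mono) (rule approx)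
  ultimately have "- 2 * 0 * I \<le> h (x b) - h (x a)"
    by (rule tendsto_upperbound) (rule trivial_limit_at_right_real)
  then show ?thesis by simp
qed

section \<open>Uniqueness for the integral equation\<close>

text \<open>Integrating factor: with \<open>E\<close> the integral of \<open>e\<close>, the
  derivative of \<open>exp (- K * t) * E t\<close> is nonpositive and \<open>E 0 = 0\<close>. Hence
  \<open>E t\<close> is at most 0, and the integral bound then forces \<open>e t\<close> to be at
  most 0 as well.\<close>

lemma gronwall_zero:
  fixes e :: "real \<Rightarrow> real"
  assumes cont: "continuous_on {0..T} e"
    and nonneg: "\<And>t. t \<in> {0..T} \<Longrightarrow> 0 \<le> e t"
    and le: "\<And>t. t \<in> {0..T} \<Longrightarrow> e t \<le> K * integral {0..t} e"
    and "0 \<le> K" "t \<in> {0..T}"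
  shows "e t = 0"
proof -
  define E where "E = (\<lambda>t. integral {0..t} e)"
  have "exp (- K * t) * E t \<le> exp (- K * 0) * E 0"
  proof (cases "t = 0")
    case False
    have der: "((\<lambda>r. exp (- K * r) * E r) has_real_derivative exp (- K * r) * (e r - K * E r))
        (at r within {0..t})" if "r \<in> {0..t}" for r
    proof -
      have "continuous_on {0..t} e"
        using cont \<open>t \<in> {0..T}\<close> by (auto intro: continuous_on_subset)
      then have "(E has_real_derivative e r) (at r within {0..t})"
        unfolding E_def using that by (rule integral_has_real_derivative)
      then show ?thesis
        by (auto intro!: derivative_eq_intros simp: algebra_simps)
    qed
    then obtain r where r: "r \<in> {0..t}"
      "exp (- K * t) * E t - exp (- K * 0) * E 0 = exp (- K * r) * (e r - K * E r) * (t - 0)"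
      using mvt_very_simple[of 0 t "\<lambda>r. exp (- K * r) * E r"
          "\<lambda>r. (*) (exp (- K * r) * (e r - K * E r))"] \<open>t \<in> {0..T}\<close>
      by (auto simp: has_field_derivative_def)
    moreover have "e r - K * E r \<le> 0"
      using le[of r] r(1) \<open>t \<in> {0..T}\<close> by (auto simp: E_def)
    ultimately show ?thesis
      using \<open>t \<in> {0..T}\<close>
      by (smt (verit) atLeastAtMost_iff exp_ge_zero mult_nonneg_nonpos mult_nonneg_nonneg mult_nonpos_nonneg)
  qed auto
  then have "E t \<le> 0"
    by (simp add: E_def mult_le_0_iff)
  then show ?thesis
    using le[of t] nonneg[of t] \<open>t \<in> {0..T}\<close> \<open>0 \<le> K\<close>
    by (smt (verit) E_def mult_nonneg_nonpos)
qed

text \<open>Joint local Lipschitz continuity implies the library notion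
  \<open>local_lipschitz\<close>, which is Lipschitz in the state, locally uniformly in time.
  Together with continuity in time, compactness then yields one constant for all of \<open>T\<close>
  and \<open>X\<close>.\<close>

lemma locally_lipschitz_on_compact:
  assumes F: "locally_lipschitz (\<lambda>(t, x). F t x)"
    and "compact T" "compact X"
  shows "\<exists>L\<ge>0. \<forall>t\<in>T. \<forall>x\<in>X. \<forall>y\<in>X. dist (F t x) (F t y) \<le> L * dist x y"
proof -
  have ll: "local_lipschitz T X F"
  proof (rule local_lipschitzI)
    fix t x
    obtain \<epsilon> L where \<epsilon>: "\<epsilon> > 0" and L: "L-lipschitz_on (ball (t, x) \<epsilon>) (\<lambda>(t, x). F t x)"
      using F unfolding locally_lipschitz_def by blast
    \<comment> \<open>The product distance is at most the sum of the two component distances, here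
      at most two thirds of \<epsilon>, so the pairs stay in the open ball.\<close>
    have "L-lipschitz_on (cball x (\<epsilon> / 3) \<inter> X) (F s)" if "s \<in> cball t (\<epsilon> / 3)" for s
    proof (rule lipschitz_onI)
      have mem: "(s, y) \<in> ball (t, x) \<epsilon>" if "y \<in> cball x (\<epsilon> / 3)" for y
        using that \<open>s \<in> cball t (\<epsilon> / 3)\<close> \<epsilon> sqrt_sum_squares_le_sum_abs[of "dist t s" "dist x y"]
        by (auto simp: dist_Pair_Pair)
      show "dist (F s y) (F s z) \<le> L * dist y z"
        if "y \<in> cball x (\<epsilon> / 3) \<inter> X" "z \<in> cball x (\<epsilon> / 3) \<inter> X" for y z
        using lipschitz_onD[OF L mem mem, of y z] that by (auto simp: dist_Pair_Pair)
      show "0 \<le> L"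
        using L by (rule lipschitz_on_nonneg)
    qed
    then show "\<exists>u>0. \<exists>L. \<forall>t\<in>cball t u \<inter> T. L-lipschitz_on (cball x u \<inter> X) (F t)"
      using \<epsilon> by (intro exI[of _ "\<epsilon> / 3"] conjI exI[of _ L]) auto
  qed
  have "continuous_on UNIV (\<lambda>(t, x). F t x)"
    unfolding continuous_on_eq_continuous_at[OF open_UNIV]
  proof
    fix p
    obtain \<epsilon> L where "\<epsilon> > 0" "L-lipschitz_on (ball p \<epsilon>) (\<lambda>(t, x). F t x)"
      using F unfolding locally_lipschitz_def by blast
    then show "isCont (\<lambda>(t, x). F t x) p"
      by (metis centre_in_ball continuous_on_eq_continuous_at lipschitz_on_continuous_on open_ball)
  qed
  then have "continuous_on T (\<lambda>t. F t x)" for x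
    using continuous_on_compose2[of UNIV "\<lambda>(t, x). F t x" T "\<lambda>t. (t, x)"]
    by (simp add: continuous_intros)
  from local_lipschitz_compact_implies_lipschitz[OF ll \<open>compact X\<close> \<open>compact T\<close> this]
  obtain L where L: "\<And>t. t \<in> T \<Longrightarrow> L-lipschitz_on X (F t)"
    by blast
  \<comment> \<open>The absolute value secures a nonnegative constant even when \<open>T\<close> is
    empty and nothing is known about \<open>L\<close>.\<close>
  have "dist (F t x) (F t y) \<le> \<bar>L\<bar> * dist x y" if "t \<in> T" "x \<in> X" "y \<in> X" for t x y
    using lipschitz_onD[OF L that(2,3)] that(1)
    by (meson abs_ge_self mult_right_mono order_trans zero_le_dist)
  then show ?thesis
    by (intro exI[of _ "\<bar>L\<bar>"]) auto
qed

text \<open>Both solutions are continuous, so their images over the window lie in a compact set on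
  which \<open>f\<close> and \<open>g\<close> have uniform Lipschitz constants in the state. The
  bound on \<open>v\<close> makes the whole right-hand side Lipschitz there, and Gronwall applies to
  the norm of the difference.\<close>

lemma integral_equation_unique:
  fixes y z :: "real \<Rightarrow> real^'n" and g :: "real \<Rightarrow> real^'n \<Rightarrow> real^'m^'n"
  assumes f: "locally_lipschitz (\<lambda>(t, x). f t x)"
    and g: "locally_lipschitz (\<lambda>(t, x). g t x)"
    and v: "\<And>s. s \<in> {0..T} \<Longrightarrow> norm (v s) \<le> C"
    and inty: "(\<lambda>s. vector_field f g (t + s) (y s) (v s)) integrable_on {0..T}"
    and y: "\<And>\<theta>. \<theta> \<in> {0..T} \<Longrightarrow>
      y \<theta> = p + integral {0..\<theta>} (\<lambda>s. vector_field f g (t + s) (y s) (v s))"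
    and intz: "(\<lambda>s. vector_field f g (t + s) (z s) (v s)) integrable_on {0..T}"
    and z: "\<And>\<theta>. \<theta> \<in> {0..T} \<Longrightarrow>
      z \<theta> = p + integral {0..\<theta>} (\<lambda>s. vector_field f g (t + s) (z s) (v s))"
    and "\<theta> \<in> {0..T}"
  shows "y \<theta> = z \<theta>"
proof -
  define G where "G = (\<lambda>y s. vector_field f g (t + s) (y s) (v s))"
  have intG: "G y integrable_on {0..r}" "G z integrable_on {0..r}" if "r \<le> T" for r
    using that unfolding G_def
    by (auto intro: integrable_on_subinterval[OF inty] integrable_on_subinterval[OF intz])
  have "continuous_on {0..T} (\<lambda>r. p + integral {0..r} (G y))"
    "continuous_on {0..T} (\<lambda>r. p + integral {0..r} (G z))"
    by (intro continuous_intros indefinite_integral_continuous_1 intG order_refl)+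
  then have cy: "continuous_on {0..T} y" and cz: "continuous_on {0..T} z"
    using y z continuous_on_cong[OF refl, of "{0..T}" y "\<lambda>r. p + integral {0..r} (G y)"]
      continuous_on_cong[OF refl, of "{0..T}" z "\<lambda>r. p + integral {0..r} (G z)"]
    by (simp_all add: G_def)
  define X where "X = y ` {0..T} \<union> z ` {0..T}"
  have X: "compact X" "compact {t..t + T}"
    using cy cz by (auto simp: X_def intro: compact_continuous_image)
  obtain L where L: "L \<ge> 0"
    "\<And>s a b. s \<in> {t..t + T} \<Longrightarrow> a \<in> X \<Longrightarrow> b \<in> X \<Longrightarrow> norm (f s a - f s b) \<le> L * norm (a - b)"
    using locally_lipschitz_on_compact[OF f X(2,1)] by (metis dist_norm)
  obtain M where M: "M \<ge> 0"
    "\<And>s a b. s \<in> {t..t + T} \<Longrightarrow> a \<in> X \<Longrightarrow> b \<in> X \<Longrightarrow> norm (g s a - g s b) \<le> M * norm (a - b)"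
    using locally_lipschitz_on_compact[OF g X(2,1)] by (metis dist_norm)
  have "bounded_bilinear ((*v) :: real^'m^'n \<Rightarrow> _)"
    unfolding bilinear_conv_bounded_bilinear[symmetric] bilinear_def
    by (auto intro!: linearI simp: matrix_vector_mult_add_rdistrib matrix_vector_right_distrib
        scaleR_matrix_vector_assoc matrix_vector_mult_scaleR)
  then obtain B where B: "B \<ge> 0" "\<And>(A :: real^'m^'n) w. norm (A *v w) \<le> norm A * norm w * B"
    using bounded_bilinear.nonneg_bounded by metis
  \<comment> \<open>\<open>L\<close> accounts for \<open>f\<close>. In the input term,
    \<open>M\<close> is the Lipschitz constant of \<open>g\<close>, \<open>C\<close> bounds the
    input, and \<open>B\<close> is the bilinear bound of the matrix-vector product.\<close>
  define K where "K = L + M * C * B"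
  have "C \<ge> 0"
    using v[of \<theta>] \<open>\<theta> \<in> {0..T}\<close> norm_ge_zero order_trans by blast
  have "K \<ge> 0"
    using L(1) M(1) B(1) \<open>C \<ge> 0\<close> by (simp add: K_def)
  have lip: "norm (G y s - G z s) \<le> K * norm (y s - z s)" if s: "s \<in> {0..T}" for s
  proof -
    have mem: "t + s \<in> {t..t + T}" "y s \<in> X" "z s \<in> X"
      using s by (auto simp: X_def)
    have "G y s - G z s = (f (t + s) (y s) - f (t + s) (z s)) + (g (t + s) (y s) - g (t + s) (z s)) *v v s"
      by (simp add: G_def vector_field_def matrix_vector_mult_diff_rdistrib)
    then have "norm (G y s - G z s)
        \<le> norm (f (t + s) (y s) - f (t + s) (z s)) + norm ((g (t + s) (y s) - g (t + s) (z s)) *v v s)"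
      by (simp add: norm_triangle_ineq)
    also have "\<dots> \<le> L * norm (y s - z s) + (M * norm (y s - z s)) * C * B"
    proof (rule add_mono[OF L(2)[OF mem]])
      have "norm ((g (t + s) (y s) - g (t + s) (z s)) *v v s)
          \<le> norm (g (t + s) (y s) - g (t + s) (z s)) * norm (v s) * B"
        by (rule B(2))
      also have "\<dots> \<le> (M * norm (y s - z s)) * C * B"
        using M(1) B(1) \<open>C \<ge> 0\<close> by (intro mult_mono M(2)[OF mem] v[OF s]) auto
      finally show "norm ((g (t + s) (y s) - g (t + s) (z s)) *v v s)
        \<le> (M * norm (y s - z s)) * C * B" .
    qed
    finally show ?thesis
      by (simp add: K_def algebra_simps)
  qed
  have ce: "continuous_on {0..T} (\<lambda>s. norm (y s - z s))"
    by (intro continuous_intros cy cz)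
  have "norm (y r - z r) \<le> K * integral {0..r} (\<lambda>s. norm (y s - z s))" if r: "r \<in> {0..T}" for r
  proof -
    have "(\<lambda>s. norm (y s - z s)) integrable_on {0..r}"
      using ce r by (intro integrable_continuous_real) (auto elim: continuous_on_subset)
    then have "norm (integral {0..r} (\<lambda>s. G y s - G z s)) \<le> integral {0..r} (\<lambda>s. K * norm (y s - z s))"
      using intG[of r] r lip
      by (intro integral_norm_bound_integral integrable_diff integrable_on_mult_right) auto
    moreover have "y r - z r = integral {0..r} (\<lambda>s. G y s - G z s)"
      using y[OF r] z[OF r] intG[of r] r by (simp add: integral_diff G_def)
    ultimately show ?thesis by simp
  qed
  from gronwall_zero[OF ce _ this \<open>K \<ge> 0\<close> \<open>\<theta> \<in> {0..T}\<close>] show ?thesis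
    by simp
qed

section \<open>The semi-flow predicts the closed-loop state\<close>

text \<open>The solution shifted by \<open>t\<close> and the semi-flow started at \<open>x t\<close>
  satisfy the same integral equation on a window of length \<tau>, with the same bounded input;
  uniqueness identifies them.\<close>

lemma closed_loop_solution_predictor:
  fixes g :: "real \<Rightarrow> real^'n \<Rightarrow> real^'m^'n"
  assumes "\<tau> > 0"
    and f: "locally_lipschitz (\<lambda>(t, x). f t x)"
    and g: "locally_lipschitz (\<lambda>(t, x). g t x)"
    and d: "\<And>t. t \<ge> 0 \<Longrightarrow> norm (d t) \<le> \<delta>"
    and \<Psi>: "semiflow \<tau> f g d \<Psi>"
    and sol: "closed_loop_solution \<tau> f g d k x u"
    and "t \<ge> 0"
  shows "x (t + \<tau>) = \<Psi> \<tau> t (x t) (history \<tau> u t)"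
proof -
  define \<phi> where "\<phi> = history \<tau> u t"
  define v where "v = (\<lambda>s. \<phi> (s - \<tau>) + d (t + s))"
  define F where "F = (\<lambda>s. vector_field f g s (x s) (u (s - \<tau>) + d s))"
  have \<phi>: "\<phi> \<in> histories \<tau>"
    using sol \<open>t \<ge> 0\<close> by (simp add: closed_loop_solution_def \<phi>_def)
  \<comment> \<open>The closed window includes \<open>s = \<tau>\<close>, where \<phi> is evaluated
    at 0, outside its domain. Adding this single value keeps the set bounded, so the input bound
    holds on all of \<open>{0..\<tau>}\<close>.\<close>
  then have "bounded (insert (\<phi> 0) (\<phi> ` {-\<tau>..<0}))"
    by (simp add: histories_def)
  then obtain C where C: "\<And>w. w \<in> insert (\<phi> 0) (\<phi> ` {-\<tau>..<0}) \<Longrightarrow> norm w \<le> C"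
    by (auto simp: bounded_iff)
  have v: "norm (v s) \<le> C + \<delta>" if "s \<in> {0..\<tau>}" for s
  proof -
    have "\<phi> (s - \<tau>) \<in> insert (\<phi> 0) (\<phi> ` {-\<tau>..<0})"
      using that by (cases "s = \<tau>") auto
    then show ?thesis
      unfolding v_def using C d[of "t + s"] that \<open>t \<ge> 0\<close> by (intro norm_triangle_le add_mono) auto
  qed
  have intF: "F integrable_on {0..r}" and x: "x r = x 0 + integral {0..r} F" if "r \<ge> 0" for r
    using sol that unfolding closed_loop_solution_def F_def absolutely_integrable_on_def by blast+
  have shifted: "((\<lambda>s. vector_field f g (t + s) (x (t + s)) (v s)) has_integral (x (t + \<theta>) - x t)) {0..\<theta>}"
    if "\<theta> \<in> {0..\<tau>}" for \<theta>
  proof -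
    have "F integrable_on {t..t + \<theta>}"
      using intF[of "t + \<theta>"] that \<open>t \<ge> 0\<close> by (auto intro: integrable_on_subinterval)
    moreover have "x (t + \<theta>) - x t = integral {t..t + \<theta>} F"
      using Henstock_Kurzweil_Integration.integral_combine[of 0 t "t + \<theta>" F] intF[of "t + \<theta>"]
        x[of t] x[of "t + \<theta>"] that \<open>t \<ge> 0\<close> by (auto simp: algebra_simps)
    ultimately have "(F has_integral (x (t + \<theta>) - x t)) {t..t + \<theta>}"
      by (simp add: has_integral_integral)
    from has_integral_shift_real_ivl[OF this, of t]
    have "((\<lambda>s. F (s + t)) has_integral (x (t + \<theta>) - x t)) {0..\<theta>}"
      by simp
    then show ?thesis
      \<comment> \<open>The integrands differ only at \<open>s = \<tau>\<close>, where \<open>\<phi> 0\<close> is junk.\<close>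
    proof (rule has_integral_spike_finite[where S = "{\<tau>}", rotated 2])
      fix s
      assume "s \<in> {0..\<theta>} - {\<tau>}"
      then have "\<phi> (s - \<tau>) = u (t + (s - \<tau>))"
        using that by (auto simp: \<phi>_def history_def)
      then show "vector_field f g (t + s) (x (t + s)) (v s) = F (s + t)"
        by (simp add: F_def v_def algebra_simps)
    qed simp
  qed
  have "x (t + \<tau>) = \<Psi> \<tau> t (x t) \<phi>"
  proof (rule integral_equation_unique[OF f g v, where y = "\<lambda>s. x (t + s)" and z = "\<lambda>s. \<Psi> s t (x t) \<phi>"
        and p = "x t" and t = t])
    show "(\<lambda>s. vector_field f g (t + s) (x (t + s)) (v s)) integrable_on {0..\<tau>}"
      using shifted[of \<tau>] \<open>\<tau> > 0\<close> by auto
    show "x (t + \<theta>) = x t + integral {0..\<theta>} (\<lambda>s. vector_field f g (t + s) (x (t + s)) (v s))"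
      if "\<theta> \<in> {0..\<tau>}" for \<theta>
      using integral_unique[OF shifted[OF that]] by simp
    show "(\<lambda>s. vector_field f g (t + s) (\<Psi> s t (x t) \<phi>) (v s)) integrable_on {0..\<tau>}"
      using \<Psi> \<phi> \<open>\<tau> > 0\<close> unfolding semiflow_def v_def absolutely_integrable_on_def by force
    show "\<Psi> \<theta> t (x t) \<phi> = x t + integral {0..\<theta>} (\<lambda>s. vector_field f g (t + s) (\<Psi> s t (x t) \<phi>) (v s))"
      if "\<theta> \<in> {0..\<tau>}" for \<theta>
      using \<Psi> \<phi> that unfolding semiflow_def v_def by blast
  qed (use \<open>\<tau> > 0\<close> in auto)
  then show ?thesis
    by (simp add: \<phi>_def)
qed

section \<open>The safe set as a sign condition, and the barrier rate\<close>

text \<open>The limits give values on either side of any target, and the intermediate value theorem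
  does the rest. Surjectivity makes \<open>inv \<alpha>\<close> a genuine right inverse, as
  \<open>tissf_gamma\<close> requires.\<close>

lemma ext_class_K_inf_surj:
  assumes "\<alpha> \<in> ext_class_K_inf"
  shows "surj \<alpha>"
proof (rule surjI)
  fix y
  have lims: "filterlim \<alpha> at_top at_top" "filterlim \<alpha> at_bot at_bot"
    and cont: "continuous_on UNIV \<alpha>" and "strict_mono \<alpha>"
    using assms by (auto simp: ext_class_K_inf_def)
  obtain b where "y \<le> \<alpha> b"
    using lims(1) by (metis filterlim_at_top eventually_at_top_linorder order_refl)
  moreover obtain a where "\<alpha> a \<le> y"
    using lims(2) by (metis filterlim_at_bot eventually_at_bot_linorder order_refl)
  moreover from calculation have "a \<le> b"
    using \<open>strict_mono \<alpha>\<close> by (metis order_trans strict_mono_less_eq)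
  ultimately obtain c where "\<alpha> c = y"
    using IVT'[of \<alpha> a y b] cont by (auto intro: continuous_on_subset)
  then show "\<alpha> (inv \<alpha> y) = y"
    by (metis f_inv_into_f rangeI)
qed

text \<open>Applying the strictly increasing \<alpha> to both sides of the comparison with
  \<open>h x\<close> removes the inverse, so the invariance argument never has to differentiate
  \<open>h_delta\<close>.\<close>

lemma h_delta_nonneg_iff:
  assumes "\<alpha> \<in> ext_class_K_inf"
  shows "h_delta \<alpha> \<sigma> h \<delta> x \<ge> 0 \<longleftrightarrow> \<alpha> (h x) + \<delta>\<^sup>2 / (4 * \<sigma> (h x)) \<ge> 0"
proof -
  have "h_delta \<alpha> \<sigma> h \<delta> x \<ge> 0 \<longleftrightarrow> inv \<alpha> (- (\<delta>\<^sup>2 / (4 * \<sigma> (h x)))) \<le> h x"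
    by (simp add: h_delta_def tissf_gamma_def)
  also have "\<dots> \<longleftrightarrow> \<alpha> (inv \<alpha> (- (\<delta>\<^sup>2 / (4 * \<sigma> (h x))))) \<le> \<alpha> (h x)"
    using assms by (simp add: ext_class_K_inf_def strict_mono_less_eq)
  finally show ?thesis
    by (auto simp: surj_f_inv_f[OF ext_class_K_inf_surj[OF assms]])
qed

text \<open>Completing the square absorbs the disturbance term into the margin
  \<open>\<sigma> * (norm Lgh)\<^sup>2\<close>.\<close>

lemma gradient_inner_disturbed_ge:
  assumes "hdot f g h t x w \<ge> - a + s * (norm (Lg g h t x))\<^sup>2"
    and "s > 0" and "norm v \<le> \<delta>"
  shows "gradient h x \<bullet> vector_field f g t x (w + v) \<ge> - (a + \<delta>\<^sup>2 / (4 * s))"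
proof -
  define n where "n = norm (Lg g h t x)"
  have "- (n * \<delta>) \<le> Lg g h t x \<bullet> v"
    using norm_cauchy_schwarz[of "Lg g h t x" "- v"] mult_left_mono[OF assms(3), of n]
    by (simp add: n_def)
  moreover have "gradient h x \<bullet> vector_field f g t x (w + v) = hdot f g h t x w + Lg g h t x \<bullet> v"
    by (simp add: vector_field_def hdot_def Lf_def Lg_def inner_add_right
        matrix_vector_right_distrib dot_lmul_matrix)
  moreover have "s * n\<^sup>2 - n * \<delta> + \<delta>\<^sup>2 / (4 * s) = s * (n - \<delta> / (2 * s))\<^sup>2"
    using \<open>s > 0\<close> by (simp add: field_simps power2_eq_square)
  then have "s * n\<^sup>2 - n * \<delta> + \<delta>\<^sup>2 / (4 * s) \<ge> 0"
    using \<open>s > 0\<close> by simp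
  ultimately show ?thesis
    using assms(1) by (simp add: n_def)
qed

text \<open>A nonincreasing positive \<sigma> makes the added quotient nondecreasing, so the
  strictness of \<alpha> survives. This is where the sign of the derivative of \<sigma>
  enters.\<close>

lemma strict_mono_barrier_rate:
  fixes \<alpha> \<sigma> :: "real \<Rightarrow> real"
  assumes "strict_mono \<alpha>" and pos: "\<And>r. \<sigma> r > 0" and "antimono \<sigma>"
  shows "strict_mono (\<lambda>r. \<alpha> r + \<delta>\<^sup>2 / (4 * \<sigma> r))"
proof (rule strict_monoI)
  fix r s :: real
  assume "r < s"
  then have "\<sigma> s \<le> \<sigma> r"
    using \<open>antimono \<sigma>\<close> by (simp add: antimonoD)
  then have "\<delta>\<^sup>2 / (4 * \<sigma> r) \<le> \<delta>\<^sup>2 / (4 * \<sigma> s)"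
    using pos by (intro divide_left_mono) auto
  then show "\<alpha> r + \<delta>\<^sup>2 / (4 * \<sigma> r) < \<alpha> s + \<delta>\<^sup>2 / (4 * \<sigma> s)"
    using \<open>strict_mono \<alpha>\<close> \<open>r < s\<close> strict_monoD by fastforce
qed

section \<open>Forward invariance of the safe set\<close>

theorem theorem8:
  fixes \<tau> \<delta> :: real
    and f :: "real \<Rightarrow> real^'n \<Rightarrow> real^'n"
    and g :: "real \<Rightarrow> real^'n \<Rightarrow> real^'m^'n"
    and d :: "real \<Rightarrow> real^'m"
    and h :: "real^'n \<Rightarrow> real"
    and \<sigma> \<alpha> :: "real \<Rightarrow> real"
    and \<Psi> :: "real \<Rightarrow> real \<Rightarrow> real^'n \<Rightarrow> (real \<Rightarrow> real^'m) \<Rightarrow> real^'n"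
    and k :: "real \<Rightarrow> real^'n \<Rightarrow> (real \<Rightarrow> real^'m) \<Rightarrow> real^'m"
  assumes "\<tau> > 0" and "\<delta> \<ge> 0"
    and "locally_lipschitz (\<lambda>(t, x). f t x)"
    and "locally_lipschitz (\<lambda>(t, x). g t x)"
    and "\<And>t. t \<ge> 0 \<Longrightarrow> norm (d t) \<le> \<delta>"
    and "semiflow \<tau> f g d \<Psi>"
    and "continuously_differentiable h"
    and "\<sigma> C1_differentiable_on UNIV"
    and "\<And>r. \<sigma> r > 0"
    and "\<And>r. deriv \<sigma> r \<le> 0"
    and "TISSf_CBF_with \<tau> f g \<Psi> \<sigma> \<alpha> h"
    and "inv \<alpha> \<in> ext_class_K_inf"
    and "inv \<alpha> C1_differentiable_on UNIV"
    and "locally_lipschitz_controller \<tau> k"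
    and "\<And>t x \<phi> tp xp. t \<ge> 0 \<Longrightarrow> \<phi> \<in> histories \<tau> \<Longrightarrow> tp = t + \<tau> \<Longrightarrow> xp = \<Psi> \<tau> t x \<phi> \<Longrightarrow>
           hdot f g h tp xp (k t x \<phi>) \<ge> - \<alpha> (h xp) + \<sigma> (h xp) * (norm (Lg g h tp xp))\<^sup>2"
  shows "\<forall>x u. closed_loop_solution \<tau> f g d k x u \<longrightarrow>
           (\<forall>t\<in>{0..\<tau>}. x t \<in> S_delta \<alpha> \<sigma> h \<delta>) \<longrightarrow> (\<forall>t\<ge>0. x t \<in> S_delta \<alpha> \<sigma> h \<delta>)"
proof (intro allI impI)
  fix x :: "real \<Rightarrow> real^'n" and u :: "real \<Rightarrow> real^'m" and t :: real
  assume sol: "closed_loop_solution \<tau> f g d k x u"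
    and init: "\<forall>t\<in>{0..\<tau>}. x t \<in> S_delta \<alpha> \<sigma> h \<delta>" and "0 \<le> t"
  define \<beta> where "\<beta> = (\<lambda>r. \<alpha> r + \<delta>\<^sup>2 / (4 * \<sigma> r))"
  define F where "F = (\<lambda>s. vector_field f g s (x s) (u (s - \<tau>) + d s))"
  have \<alpha>: "\<alpha> \<in> ext_class_K_inf"
    using assms(11) by (simp add: TISSf_CBF_with_def)
  have S_iff: "y \<in> S_delta \<alpha> \<sigma> h \<delta> \<longleftrightarrow> \<beta> (h y) \<ge> 0" for y
    by (simp add: S_delta_def h_delta_nonneg_iff[OF \<alpha>] \<beta>_def)
  \<comment> \<open>The C1 hypothesis supplies some derivative function; identifying it with
    \<open>deriv \<sigma>\<close> makes the sign hypothesis applicable.\<close>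
  have \<sigma>_deriv: "(\<sigma> has_real_derivative deriv \<sigma> r) (at r)" for r
  proof -
    obtain D where "(\<sigma> has_real_derivative D r) (at r)"
      using assms(8) by (auto simp: C1_differentiable_on_def has_real_derivative_iff_has_vector_derivative)
    then show ?thesis
      using DERIV_imp_deriv by metis
  qed
  then have "antimono \<sigma>"
    using assms(10) by (intro antimonoI DERIV_nonpos_imp_nonincreasing[of _ _ \<sigma>]) auto
  then have "strict_mono \<beta>"
    unfolding \<beta>_def using \<alpha> assms(9)
    by (intro strict_mono_barrier_rate) (auto simp: ext_class_K_inf_def)
  have "continuous_on UNIV \<sigma>"
    using \<sigma>_deriv DERIV_isCont by (blast intro: continuous_at_imp_continuous_on)
  then have cont_\<beta>: "continuous_on UNIV \<beta>"
    unfolding \<beta>_def using \<alpha> less_imp_neq[OF assms(9)]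
    by (intro continuous_intros) (auto simp: ext_class_K_inf_def)
  have "continuous_on UNIV h"
    using assms(7) unfolding continuously_differentiable_def
    by (blast intro: continuous_at_imp_continuous_on differentiable_imp_continuous_within)
  have absF: "F absolutely_integrable_on {0..r}" and x: "x r = x 0 + integral {0..r} F" if "r \<ge> 0" for r
    using sol that unfolding closed_loop_solution_def F_def by blast+
  then have intF: "F integrable_on {0..r}" if "r \<ge> 0" for r
    using that set_lebesgue_integral_eq_integral(1) by blast
  have "continuous_on {0..t} (\<lambda>r. x 0 + integral {0..r} F)"
    using intF \<open>0 \<le> t\<close> by (intro continuous_intros indefinite_integral_continuous_1)
  then have "continuous_on {0..t} x"
    by (rule continuous_on_eq) (auto simp: x[symmetric])
  then have cont0: "continuous_on {0..t} (\<lambda>s. \<beta> (h (x s)))"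
    using continuous_on_compose2[OF cont_\<beta> continuous_on_compose2[OF \<open>continuous_on UNIV h\<close>]] by blast
  have "0 \<le> \<tau>"
    using \<open>\<tau> > 0\<close> by simp
  have cont: "continuous_on {s..t} (\<lambda>s. \<beta> (h (x s)))" if "\<tau> \<le> s" for s
    by (rule continuous_on_subset[OF cont0]) (use that \<open>0 \<le> \<tau>\<close> in auto)
  \<comment> \<open>The input acting at time \<open>s\<close> was chosen at
    \<open>s - \<tau>\<close>, using the prediction of \<open>x s\<close>. The controller law is
    imposed only from time 0 on, hence the restriction to \<open>s\<close> at least \<tau>; before
    that the initial hypothesis covers the solution.\<close>
  have rate: "- \<beta> (h (x s)) \<le> gradient h (x s) \<bullet> F s" if "\<tau> \<le> s" for s
  proof -
    define \<phi> where "\<phi> = history \<tau> u (s - \<tau>)"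
    have "\<phi> \<in> histories \<tau>" "u (s - \<tau>) = k (s - \<tau>) (x (s - \<tau>)) \<phi>"
      using sol that unfolding closed_loop_solution_def \<phi>_def
      by (metis diff_ge_0_iff_ge)+
    moreover have "x s = \<Psi> \<tau> (s - \<tau>) (x (s - \<tau>)) \<phi>"
      using closed_loop_solution_predictor[OF assms(1,3,4,5,6) sol, of "s - \<tau>"] that
      by (simp add: \<phi>_def)
    ultimately have "hdot f g h s (x s) (u (s - \<tau>))
        \<ge> - \<alpha> (h (x s)) + \<sigma> (h (x s)) * (norm (Lg g h s (x s)))\<^sup>2"
      using assms(15)[of "s - \<tau>" \<phi> s "x s" "x (s - \<tau>)"] that by simp
    then show ?thesis
      unfolding F_def \<beta>_def using assms(5)[of s] assms(9) that \<open>0 \<le> \<tau>\<close>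
      by (intro gradient_inner_disturbed_ge) auto
  qed
  show "x t \<in> S_delta \<alpha> \<sigma> h \<delta>"
  proof (rule ccontr)
    assume "x t \<notin> S_delta \<alpha> \<sigma> h \<delta>"
    then have neg: "\<beta> (h (x t)) < 0"
      by (simp add: S_iff)
    have "\<tau> \<le> t"
      using init \<open>0 \<le> t\<close> \<open>x t \<notin> S_delta \<alpha> \<sigma> h \<delta>\<close> by force
    \<comment> \<open>The set of safe times in the interval is compact and contains \<tau>, so there
      is a last safe time \<open>t0\<close>.\<close>
    define Z where "Z = {s \<in> {\<tau>..t}. 0 \<le> \<beta> (h (x s))}"
    have "closed Z"
      unfolding Z_def by (intro continuous_on_closed_Collect_le continuous_intros cont) auto
    moreover have "bounded Z"
      unfolding Z_def by (rule bounded_subset[OF bounded_closed_interval[of \<tau> t]]) auto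
    ultimately have "compact Z"
      by (simp add: compact_eq_bounded_closed)
    moreover have "\<tau> \<in> Z"
      using init \<open>0 \<le> \<tau>\<close> \<open>\<tau> \<le> t\<close> S_iff by (auto simp: Z_def)
    ultimately obtain t0 where t0: "t0 \<in> Z" "\<And>s. s \<in> Z \<Longrightarrow> s \<le> t0"
      using compact_attains_sup[of Z] by auto
    then have "\<tau> \<le> t0" "t0 \<le> t" "0 \<le> \<beta> (h (x t0))"
      by (auto simp: Z_def)
    \<comment> \<open>A zero of the rate between \<open>t0\<close> and \<open>t\<close> is itself a
      safe time, so maximality forces it to be \<open>t0\<close>. Thus the rate is exactly 0 at
      \<open>t0\<close> and negative afterwards, which gives the sign needed on the closed interval,
      left end point included.\<close>
    then obtain c where c: "t0 \<le> c" "c \<le> t" "\<beta> (h (x c)) = 0"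
      using IVT2'[of "\<lambda>s. \<beta> (h (x s))" t 0 t0] neg cont by auto
    then have "c = t0"
      using t0(2)[of c] \<open>\<tau> \<le> t0\<close> by (auto simp: Z_def)
    have "\<beta> (h (x s)) \<le> 0" if "s \<in> {t0..t}" for s
      using t0(2)[of s] that c(3) \<open>c = t0\<close> \<open>\<tau> \<le> t0\<close>
      by (cases "s = t0") (auto simp: Z_def intro: ccontr)
    then have "0 \<le> gradient h (x s) \<bullet> F s" if "s \<in> {t0..t}" for s
      using rate[of s] that \<open>\<tau> \<le> t0\<close> by force
    moreover have "F absolutely_integrable_on {t0..t}"
      using absF[OF \<open>0 \<le> t\<close>] \<open>\<tau> \<le> t0\<close> \<open>0 \<le> \<tau>\<close>
      by (auto intro: absolutely_integrable_on_subinterval)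
    moreover have "x s = x t0 + integral {t0..s} F" if "s \<in> {t0..t}" for s
      using Henstock_Kurzweil_Integration.integral_combine[of 0 t0 s F] intF[of s] x[of t0] x[of s] that
        \<open>\<tau> \<le> t0\<close> \<open>0 \<le> \<tau>\<close> by (auto simp: algebra_simps)
    ultimately have "h (x t0) \<le> h (x t)"
      using nondecreasing_along_integral_curve[OF assms(7)] \<open>t0 \<le> t\<close> by blast
    \<comment> \<open>Monotonicity of \<beta> turns the growth of \<open>h\<close> into a
      contradiction: the left side is nonnegative, the right side negative.\<close>
    then have "\<beta> (h (x t0)) \<le> \<beta> (h (x t))"
      using \<open>strict_mono \<beta>\<close> by (simp add: strict_mono_less_eq)
    with neg \<open>0 \<le> \<beta> (h (x t0))\<close> show False
      by simp
  qed
qed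

end
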